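(* Let $d\ge 1$ and let $A$ be a $d\times d$ expanding integer matrix such that for some positive integer $k$ the matrix $A^k$ is diagonalizable with integer eigenvalues. Then the induced expanding toral endomorphism $f=f_A:\mathbb{T}^d\to\mathbb{T}^d$ admits a linear Markov partition.
   Context: A $d\times d$ integer matrix $A$ is expanding if all its (complex) eigenvalues have modulus strictly greater than $1$. It induces the expanding toral endomorphism $f_A:\mathbb{T}^d\to\mathbb{T}^d$, $\mathbb{T}^d=\mathbb{R}^d/\mathbb{Z}^d$, $f_A(x+\mathbb{Z}^d)=Ax+\mathbb{Z}^d$. The torus carries the standard quotient metric induced by the Euclidean metric. A set $R$ in a compact metric space $X$ is proper if $R=\overline{\operatorname{int}(R)}\neq\emptyset$. A Markov partition for a positively expansive system $(X,f)$ is a finite cover $\mathcal{M}=\{R_i\}_{i=1}^n$ of $X$ by proper sets with pairwise disjoint interiors such that: (1) (metrically generating) for all $(x_k)_{k\ge 0}\in\{1,\dots,n\}^{\mathbb{N}}$, the set $\bigcap_{k=0}^\infty f^{-k}(\operatorname{int}(R_{x_k}))$ consists of at most one point; (2) (Markov property) for all $R,R'\in\mathcal{M}$, if $f(\operatorname{int}(R))\cap\operatorname{int}(R')\neq\emptyset$, then each $y\in\operatorname{int}(R')$ has a unique preimage under $f$ in $R$. (Every expanding toral endomorphism is positively expansive.) The boundary of $\mathcal{M}$ is $\partial\mathcal{M}:=\bigcup_{R\in\mathcal{M}}\partial R$. The Markov partition $\mathcal{M}$ is linear if $\partial\mathcal{M}$ is piecewise linear, i.e. a finite union of images under the projection $\mathbb{R}^d\to\mathbb{T}^d$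 of compact convex polytopes of dimension at most $d-1$. *)

theory Defs
  imports "HOL-Analysis.Analysis"
begin

section \<open>The torus as a metric space\<close>

definition int_lattice :: "(real^'n) set" where
  "int_lattice = {z. \<forall>i. z $ i \<in> \<int>}"

lemma zero_int_lattice: "0 \<in> int_lattice"
  by (simp add: int_lattice_def)

lemma minus_int_lattice: "x \<in> int_lattice \<Longrightarrow> - x \<in> int_lattice"
  by (simp add: int_lattice_def)

lemma add_int_lattice: "x \<in> int_lattice \<Longrightarrow> y \<in> int_lattice \<Longrightarrow> x + y \<in> int_lattice"
  by (simp add: int_lattice_def)

lemma closed_int_lattice: "closed (int_lattice :: (real^'n) set)"
proof -
  have "closed (\<Inter>i. (\<lambda>z::real^'n. z $ i) -` \<int>)"
    by (intro closed_INT ballI closed_vimage continuous_intros) simp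
  moreover have "int_lattice = (\<Inter>i. (\<lambda>z::real^'n. z $ i) -` \<int>)"
    by (auto simp: int_lattice_def)
  ultimately show ?thesis by metis
qed

quotient_type 'n torus = "real^'n::finite" / "\<lambda>x y. x - y \<in> int_lattice"
proof (rule equivpI)
  show "reflp (\<lambda>x y::real^'n. x - y \<in> int_lattice)"
    by (simp add: reflp_def zero_int_lattice)
  show "symp (\<lambda>x y::real^'n. x - y \<in> int_lattice)"
    using minus_int_lattice by (force simp: symp_def)
  show "transp (\<lambda>x y::real^'n. x - y \<in> int_lattice)"
    using add_int_lattice by (force simp: transp_def)
qed

lift_definition torus_proj :: "real^'n \<Rightarrow> 'n::finite torus" is "\<lambda>x. x" .

lemma torus_proj_eq_iff: "torus_proj x = torus_proj y \<longleftrightarrow> x - y \<in> int_lattice"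
  by transfer simp

lemma surj_torus_proj: "\<exists>x. torus_proj x = a"
  by transfer (metis diff_self zero_int_lattice)

lemma setdist_fibres:
  "setdist (torus_proj -` {torus_proj x}) (torus_proj -` {torus_proj y}) =
   infdist (x - y) int_lattice" (is "?l = ?r")
proof (rule antisym)
  obtain z where z: "z \<in> int_lattice" "infdist (x - y) int_lattice = dist (x - y) z"
    using infdist_attains_inf[OF closed_int_lattice] zero_int_lattice by (metis empty_iff)
  have "?l \<le> dist x (y + z)"
    using z(1) by (intro setdist_le_dist) (auto simp: torus_proj_eq_iff)
  also have "\<dots> = ?r" using z(2) by (simp add: dist_norm algebra_simps)
  finally show "?l \<le> ?r" .
next
  show "?r \<le> ?l"
  proof (subst le_setdist_iff, intro conjI ballI impI)
    fix a b assume "a \<in> torus_proj -` {torus_proj x}" "b \<in> torus_proj -` {torus_proj y}"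
    then have a: "a - x \<in> int_lattice" and b: "b - y \<in> int_lattice"
      by (auto simp: torus_proj_eq_iff)
    have "(b - y) + - (a - x) \<in> int_lattice"
      by (intro add_int_lattice minus_int_lattice a b)
    then have "?r \<le> dist (x - y) ((b - y) + - (a - x))" by (rule infdist_le)
    also have "\<dots> = dist a b" by (simp add: dist_norm algebra_simps)
    finally show "?r \<le> dist a b" .
  qed auto
qed

instantiation torus :: (finite) metric_space
begin

definition dist_torus :: "'a torus \<Rightarrow> 'a torus \<Rightarrow> real" where
  "dist_torus a b = setdist (torus_proj -` {a}) (torus_proj -` {b})"

definition uniformity_torus :: "('a torus \<times> 'a torus) filter" where
  "uniformity_torus = (INF e\<in>{0 <..}. principal {(x, y). dist x y < e})"

definition open_torus :: "'a torus set \<Rightarrow> bool" where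
  "open_torus U \<longleftrightarrow> (\<forall>x\<in>U. \<forall>\<^sub>F (x', y) in uniformity. x' = x \<longrightarrow> y \<in> U)"

instance
proof
  fix a b c :: "'a torus"
  obtain x y w where [simp]: "a = torus_proj x" "b = torus_proj y" "c = torus_proj w"
    using surj_torus_proj by metis
  show "dist a b = 0 \<longleftrightarrow> a = b"
    using in_closed_iff_infdist_zero[OF closed_int_lattice] zero_int_lattice
    by (auto simp: dist_torus_def setdist_fibres torus_proj_eq_iff)
  obtain u v where u: "u \<in> int_lattice" "infdist (x - w) int_lattice = dist (x - w) u"
    and v: "v \<in> int_lattice" "infdist (y - w) int_lattice = dist (y - w) v"
    using infdist_attains_inf[OF closed_int_lattice] zero_int_lattice by (metis empty_iff)
  have "infdist (x - y) int_lattice \<le> dist (x - y) (u + - v)"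
    by (intro infdist_le add_int_lattice minus_int_lattice u v)
  also have "\<dots> = dist (x - w - u) (y - w - v)" by (simp add: dist_norm algebra_simps)
  also have "\<dots> \<le> dist (x - w) u + dist (y - w) v"
    using norm_triangle_ineq4[of "x - w - u" "y - w - v"] by (simp add: dist_norm)
  finally show "dist a b \<le> dist a c + dist b c"
    using u v by (simp add: dist_torus_def setdist_fibres)
qed (simp_all add: uniformity_torus_def open_torus_def)

end

lemma dist_torus_proj_le: "dist (torus_proj x) (torus_proj y) \<le> dist x y"
  by (auto simp: dist_torus_def intro!: setdist_le_dist)

lemma continuous_on_torus_proj: "continuous_on S torus_proj"
  unfolding continuous_on_iff using dist_torus_proj_le by (meson le_less_trans)

text \<open>The metric induces the quotient topology.\<close>

lemma open_torus_iff: "open U \<longleftrightarrow> open (torus_proj -` U)"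
proof
  assume "open U" then show "open (torus_proj -` U)"
    by (intro open_vimage continuous_on_torus_proj)
next
  assume *: "open (torus_proj -` U)"
  show "open U" unfolding open_dist
  proof
    fix a assume "a \<in> U"
    obtain x where x: "a = torus_proj x" using surj_torus_proj by metis
    then obtain e where e: "e > 0" "\<And>y. dist y x < e \<Longrightarrow> torus_proj y \<in> U"
      using * \<open>a \<in> U\<close> unfolding open_dist by auto
    have "b \<in> U" if b: "dist b a < e" for b
    proof -
      obtain y where y: "b = torus_proj y" using surj_torus_proj by metis
      obtain z where z: "z \<in> int_lattice" "infdist (y - x) int_lattice = dist (y - x) z"
        using infdist_attains_inf[OF closed_int_lattice] zero_int_lattice by (metis empty_iff)
      have "dist (y - z) x < e"
        using b z(2) by (simp add: x y dist_torus_def setdist_fibres dist_norm algebra_simps)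
      moreover have "torus_proj (y - z) = b"
        using minus_int_lattice[OF z(1)] by (simp add: y torus_proj_eq_iff)
      ultimately show ?thesis using e(2) by metis
    qed
    then show "\<exists>e>0. \<forall>y. dist y a < e \<longrightarrow> y \<in> U" using e(1) by blast
  qed
qed

lemma compact_UNIV_torus: "compact (UNIV :: 'n::finite torus set)"
proof -
  have "a \<in> torus_proj ` cbox 0 (1 :: real^'n)" for a
  proof -
    obtain x where x: "a = torus_proj x" using surj_torus_proj by metis
    have "a = torus_proj (\<chi> i. frac (x $ i))"
      by (simp add: x torus_proj_eq_iff int_lattice_def frac_def)
    moreover have "(\<chi> i. frac (x $ i)) \<in> cbox 0 (1 :: real^'n)"
      by (auto simp: mem_box_cart frac_ge_0 less_imp_le[OF frac_lt_1])
    ultimately show ?thesis by blast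
  qed
  then have "(UNIV :: 'n torus set) = torus_proj ` cbox 0 1" by blast
  then show ?thesis
    by (metis compact_continuous_image[OF continuous_on_torus_proj compact_cbox])
qed


section \<open>Integer matrices and toral endomorphisms\<close>

text \<open>The library's \<open>^\<close> and \<open>*\<close> on type \<open>vec\<close> are componentwise, so powers
  are taken with respect to the matrix product \<open>**\<close>.\<close>

primrec matrix_power :: "'a::semiring_1^'n^'n \<Rightarrow> nat \<Rightarrow> 'a^'n^'n" where
  "matrix_power A 0 = mat 1"
| "matrix_power A (Suc k) = A ** matrix_power A k"

definition matrix_eigenvalue :: "'a::field^'n^'n \<Rightarrow> 'a \<Rightarrow> bool" where
  "matrix_eigenvalue A c \<longleftrightarrow> (\<exists>v. v \<noteq> 0 \<and> A *v v = c *s v)"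

definition diagonal_matrix :: "'a::zero^'n^'n \<Rightarrow> bool" where
  "diagonal_matrix D \<longleftrightarrow> (\<forall>i j. i \<noteq> j \<longrightarrow> D $ i $ j = 0)"

definition diagonalizable_matrix :: "'a::field^'n^'n \<Rightarrow> bool" where
  "diagonalizable_matrix A \<longleftrightarrow>
    (\<exists>(P :: 'a^'n^'n) (D :: 'a^'n^'n). invertible P \<and> diagonal_matrix D \<and> A = P ** D ** matrix_inv P)"

abbreviation cmat :: "int^'n^'m \<Rightarrow> complex^'n^'m" where
  "cmat \<equiv> map_matrix of_int"

definition expanding_matrix :: "int^'n^'n \<Rightarrow> bool" where
  "expanding_matrix A \<longleftrightarrow> (\<forall>c. matrix_eigenvalue (cmat A) c \<longrightarrow> 1 < cmod c)"

lift_definition toral_endo :: "int^'n^'n \<Rightarrow> 'n::finite torus \<Rightarrow> 'n torus"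
  is "\<lambda>A x. map_matrix real_of_int A *v x"
proof -
  fix A :: "int^'n^'n" and x y :: "real^'n"
  assume *: "x - y \<in> int_lattice"
  have "map_matrix real_of_int A *v x - map_matrix real_of_int A *v y =
        map_matrix real_of_int A *v (x - y)"
    by (simp add: matrix_vector_mult_diff_distrib)
  also have "\<dots> \<in> int_lattice"
    using * by (auto simp: int_lattice_def matrix_vector_mult_def intro!: Ints_sum Ints_mult)
  finally show "map_matrix real_of_int A *v x - map_matrix real_of_int A *v y \<in> int_lattice" .
qed

lemma toral_endo_proj:
  "toral_endo A (torus_proj x) = torus_proj (map_matrix real_of_int A *v x)"
  by transfer (simp add: zero_int_lattice)


section \<open>Markov partitions\<close>

definition proper_set :: "'a::topological_space set \<Rightarrow> bool" where
  "proper_set R \<longleftrightarrow> R = closure (interior R) \<and> R \<noteq> {}"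

definition metrically_generating ::
    "('a::topological_space \<Rightarrow> 'a) \<Rightarrow> 'a set set \<Rightarrow> bool" where
  "metrically_generating f M \<longleftrightarrow>
    (\<forall>R :: nat \<Rightarrow> 'a set. (\<forall>k. R k \<in> M) \<longrightarrow>
      (\<forall>x y. x \<in> (\<Inter>k. (f ^^ k) -` interior (R k)) \<longrightarrow>
             y \<in> (\<Inter>k. (f ^^ k) -` interior (R k)) \<longrightarrow> x = y))"

definition markov_property ::
    "('a::topological_space \<Rightarrow> 'a) \<Rightarrow> 'a set set \<Rightarrow> bool" where
  "markov_property f M \<longleftrightarrow>
    (\<forall>R\<in>M. \<forall>R'\<in>M. f ` interior R \<inter> interior R' \<noteq> {} \<longrightarrow>
      (\<forall>y\<in>interior R'. \<exists>!x. x \<in> R \<and> f x = y))"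

text \<open>The ambient space is the whole type. Proper sets with disjoint interiors are distinct, so
  an indexed family \<open>R\<^sub>1, \<dots>, R\<^sub>n\<close> amounts to a finite set of sets.\<close>

definition markov_partition ::
    "('a::metric_space \<Rightarrow> 'a) \<Rightarrow> 'a set set \<Rightarrow> bool" where
  "markov_partition f M \<longleftrightarrow>
    finite M \<and> \<Union>M = UNIV \<and> (\<forall>R\<in>M. proper_set R) \<and>
    pairwise (\<lambda>R R'. interior R \<inter> interior R' = {}) M \<and>
    metrically_generating f M \<and> markov_property f M"

definition partition_boundary :: "'a::topological_space set set \<Rightarrow> 'a set" where
  "partition_boundary M = (\<Union>R\<in>M. frontier R)"

definition piecewise_linear_set :: "'n::finite torus set \<Rightarrow> bool" where
  "piecewise_linear_set S \<longleftrightarrow>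
    (\<exists>F :: (real^'n) set set. finite F \<and>
      (\<forall>P\<in>F. polytope P \<and> aff_dim P \<le> int CARD('n) - 1) \<and>
      S = (\<Union>P\<in>F. torus_proj ` P))"

definition linear_partition :: "'n::finite torus set set \<Rightarrow> bool" where
  "linear_partition M \<longleftrightarrow> piecewise_linear_set (partition_boundary M)"

end

theory Submission
  imports Defs
begin

text \<open>
  The pieces of the partition are convex polytopes cut out by finitely many families of parallel
  rational hyperplanes. Let \<open>W\<close> be a finite set of integer covectors and let the grid be the set of
  points \<open>x\<close> with \<open>w \<bullet> x \<in> \<int>\<close> for some \<open>w \<in> W\<close>. As the covectors are integral, the grid is invariant
  under \<open>\<int>\<^sup>d\<close> and descends to the torus; its complement is a union of open polytopes, the level sets of
  the floors \<open>\<lfloor>w \<bullet> x\<rfloor>\<close>.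

  The Markov property amounts to forward invariance of the grid. This holds as soon as every
  \<open>w \<in> W\<close> has a partner \<open>w' \<in> W\<close> whose pullback \<open>w' A\<close> is a nonzero integer multiple of \<open>w\<close>: if
  \<open>w \<bullet> x\<close> is an integer, so is \<open>w' \<bullet> A x\<close>. The preimage of an open cell under \<open>A\<close> then does not cross
  the grid, so it lies in a single open cell (\<open>pullback_interior_cell\<close>). Cells are small, so the
  projection and \<open>f\<^sub>A\<close> are injective on each of them; this gives uniqueness of preimages, and together
  with the expansiveness of \<open>A\<close> it gives the generating property. Boundaries are projections of facets.

  Such a \<open>W\<close> comes from the spectral hypothesis. Because \<open>A\<^sup>k\<close> is diagonalizable with integer
  eigenvalues, it has finitely many \<^emph>\<open>integer\<close> left eigenvectors \<open>v\<close> that separate points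
  (\<open>integral_left_eigenvectors\<close>). The covectors \<open>v A\<^sup>j\<close> with \<open>j < k\<close> satisfy the partner condition: for
  \<open>j > 0\<close> the partner of \<open>v A\<^sup>j\<close> is \<open>v A\<^sup>j\<^sup>-\<^sup>1\<close> with multiple \<open>1\<close>, and the partner of \<open>v\<close> is \<open>v A\<^sup>k\<^sup>-\<^sup>1\<close>, whose
  pullback \<open>v A\<^sup>k\<close> is the eigenvalue times \<open>v\<close>. Multiplying all covectors by a large integer \<open>N\<close> keeps
  this condition and shrinks the cells (\<open>exists_invariant_grid\<close>).
\<close>

section \<open>Integer eigenvectors of diagonalizable integer matrices\<close>

lemma map_matrix_of_int_mult:
  "map_matrix of_int (M ** N) = (map_matrix of_int M ** map_matrix of_int N :: 'a::ring_1^'p^'m)"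
  by (simp add: vec_eq_iff matrix_matrix_mult_def)

lemma map_matrix_of_int_power:
  "map_matrix of_int (matrix_power A k) = matrix_power (map_matrix of_int A :: 'a::ring_1^'n^'n) k"
proof (induction k)
  case 0
  then show ?case by (simp add: vec_eq_iff mat_def)
qed (simp add: map_matrix_of_int_mult)

lemma cmat_eq_iff: "cmat M = cmat N \<longleftrightarrow> M = N"
  by (simp add: vec_eq_iff)

definition diag_matrix :: "('n \<Rightarrow> 'a::zero) \<Rightarrow> 'a^'n^'n" where
  "diag_matrix g = (\<chi> i j. if i = j then g i else 0)"

lemma sum_if_mult:
  fixes a :: "'a::semiring_1"
  shows "(\<Sum>k\<in>UNIV. (if i = k then a else 0) * f k) = a * f (i::'n::finite)"
    and "(\<Sum>k\<in>UNIV. f k * (if k = i then a else 0)) = f i * a"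
proof -
  have "(\<Sum>k\<in>UNIV. (if i = k then a else 0) * f k) = (\<Sum>k\<in>UNIV. if i = k then a * f k else 0)"
    by (rule sum.cong) auto
  then show "(\<Sum>k\<in>UNIV. (if i = k then a else 0) * f k) = a * f i" by simp
  have "(\<Sum>k\<in>UNIV. f k * (if k = i then a else 0)) = (\<Sum>k\<in>UNIV. if k = i then f k * a else 0)"
    by (rule sum.cong) auto
  then show "(\<Sum>k\<in>UNIV. f k * (if k = i then a else 0)) = f i * a" by simp
qed

lemma diag_matrix_mult:
  "diag_matrix g ** diag_matrix h = diag_matrix (\<lambda>i. g i * h i)"
  for g h :: "'n::finite \<Rightarrow> 'a::semiring_1"
  by (simp add: diag_matrix_def vec_eq_iff matrix_matrix_mult_def sum_if_mult)

lemma diag_matrix_vec: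
  fixes x :: "'a::semiring_1^'n"
  shows "diag_matrix g *v x = (\<chi> i. g i * x $ i)"
  by (simp add: diag_matrix_def vec_eq_iff matrix_vector_mult_def sum_if_mult)

lemma conjugate_diag_mult:
  fixes P Q :: "'a::semiring_1^'n^'n"
  assumes "Q ** P = mat 1"
  shows "(P ** diag_matrix g ** Q) ** (P ** diag_matrix h ** Q) = P ** diag_matrix (\<lambda>i. g i * h i) ** Q"
proof -
  have "(P ** diag_matrix g ** Q) ** (P ** diag_matrix h ** Q)
      = P ** (diag_matrix g ** ((Q ** P) ** (diag_matrix h ** Q)))"
    by (simp only: matrix_mul_assoc)
  also have "\<dots> = P ** ((diag_matrix g ** diag_matrix h) ** Q)"
    by (simp add: assms matrix_mul_assoc)
  finally show ?thesis by (simp add: diag_matrix_mult matrix_mul_assoc)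
qed

lemma matrix_mult_mat_commute: "P ** mat c = mat c ** P"
  for P :: "'a::comm_semiring_1^'n::finite^'n"
  by (simp add: vec_eq_iff matrix_matrix_mult_def mat_def sum_if_mult mult.commute[of c])

lemma matrix_diff_distrib:
  fixes P Q :: "'a::comm_ring_1^'n::finite^'n"
  shows "P ** (M - N) = P ** M - P ** N" and "(M - N) ** Q = M ** Q - N ** Q"
  by (simp_all add: vec_eq_iff matrix_matrix_mult_def sum_subtractf algebra_simps)

text \<open>Lagrange interpolation at the eigenvalues. For an eigenvalue \<open>a\<close>, the matrix
  \<open>M\<^sub>a = \<Prod>\<^bsub>m \<noteq> a\<^esub> (B - m)\<close> over the other eigenvalues is an integer matrix, and \<open>M\<^sub>a B = a M\<^sub>a\<close>, so its rows
  are integer left eigenvectors. In diagonalizing coordinates \<open>M\<^sub>a\<close> is diagonal and nonzero exactly on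
  the \<open>a\<close>-eigenspace; hence a vector annihilated by every \<open>M\<^sub>a\<close> is zero.\<close>

lemma integral_left_eigenvectors:
  fixes B :: "int^'n::finite^'n"
  assumes diagonalizable: "diagonalizable_matrix (cmat B)"
    and integral: "\<And>c. matrix_eigenvalue (cmat B) c \<Longrightarrow> c \<in> \<int>"
  obtains V :: "(int^'n) set" where "finite V"
    and "\<And>v. v \<in> V \<Longrightarrow> \<exists>l. matrix_eigenvalue (cmat B) (of_int l) \<and> v v* B = l *s v"
    and "\<And>x::complex^'n. (\<And>v. v \<in> V \<Longrightarrow> (\<Sum>i\<in>UNIV. of_int (v $ i) * x $ i) = 0) \<Longrightarrow> x = 0"
proof -
  obtain P D :: "complex^'n^'n" where P: "invertible P" and D: "diagonal_matrix D"
    and B: "cmat B = P ** D ** matrix_inv P"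
    using diagonalizable unfolding diagonalizable_matrix_def by blast
  define Q where "Q = matrix_inv P"
  have PQ: "P ** Q = mat 1" and QP: "Q ** P = mat 1"
    using someI_ex[OF P[unfolded invertible_def]] by (simp_all add: Q_def matrix_inv_def)
  have D_diag: "D = diag_matrix (\<lambda>i. D $ i $ i)"
    using D by (simp add: diag_matrix_def diagonal_matrix_def vec_eq_iff)
  have eig: "matrix_eigenvalue (cmat B) (D $ i $ i)" for i
    unfolding matrix_eigenvalue_def
  proof (intro exI conjI)
    have "Q *v (P *v axis i 1) = axis i 1" by (simp add: matrix_vector_mul_assoc QP)
    then show "P *v axis i 1 \<noteq> 0"
      by (metis axis_eq_0_iff matrix_vector_mult_0_right one_neq_zero)
    have "cmat B *v (P *v axis i 1) = P *v (D *v ((Q ** P) *v axis i 1))"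
      by (simp add: B Q_def matrix_vector_mul_assoc matrix_mul_assoc)
    also have "D *v ((Q ** P) *v axis i 1) = (D $ i $ i) *s axis i 1"
      by (subst D_diag) (simp add: QP diag_matrix_vec vec_eq_iff axis_def)
    finally show "cmat B *v (P *v axis i 1) = (D $ i $ i) *s (P *v axis i 1)"
      by (simp add: vector_scalar_commute)
  qed
  then have "\<exists>l. D $ i $ i = of_int l" for i using integral Ints_cases by metis
  then obtain l where l: "\<And>i. D $ i $ i = of_int (l i)" by metis
  \<comment> \<open>In diagonalizing coordinates, the product of the factors \<open>B - m\<close> with \<open>m \<in> X\<close> has diagonal \<open>g X\<close>.\<close>
  define g :: "int set \<Rightarrow> 'n \<Rightarrow> complex" where "g X i = (\<Prod>m\<in>X. of_int (l i) - of_int m)" for X i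
  have integer_polynomial: "\<exists>M. cmat M = P ** diag_matrix (g X) ** Q" if "finite X" for X
    using that
  proof (induction X)
    case empty
    have "cmat (mat 1) = P ** diag_matrix (g {}) ** Q"
    proof -
      have "diag_matrix (g {}) = mat 1" by (simp add: diag_matrix_def mat_def g_def vec_eq_iff)
      moreover have "cmat (mat 1 :: int^'n^'n) = mat 1" by (simp add: vec_eq_iff mat_def)
      ultimately show ?thesis using PQ by simp
    qed
    then show ?case by blast
  next
    case (insert m X)
    then obtain M where M: "cmat M = P ** diag_matrix (g X) ** Q" by blast
    have "cmat (B - mat m) = cmat B - P ** mat (of_int m) ** Q"
    proof -
      have "P ** mat (of_int m) ** Q = mat (of_int m) ** (P ** Q)"
        by (simp only: matrix_mult_mat_commute[of P] matrix_mul_assoc)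
      then have "P ** mat (of_int m) ** Q = mat (of_int m)" by (simp add: PQ)
      then show ?thesis by (simp add: vec_eq_iff mat_def)
    qed
    also have "\<dots> = P ** diag_matrix (\<lambda>i. of_int (l i) - of_int m) ** Q"
    proof -
      have "diag_matrix (\<lambda>i. of_int (l i) - of_int m) = D - mat (of_int m)"
        by (subst D_diag) (simp add: l vec_eq_iff diag_matrix_def mat_def)
      then show ?thesis
        by (simp add: B Q_def matrix_diff_distrib)
    qed
    finally have factor: "cmat (B - mat m) = P ** diag_matrix (\<lambda>i. of_int (l i) - of_int m) ** Q" .
    have "cmat (M ** (B - mat m)) = P ** diag_matrix (g (insert m X)) ** Q"
    proof -
      have "g (insert m X) = (\<lambda>i. g X i * (of_int (l i) - of_int m))"
        using insert.hyps by (simp add: g_def fun_eq_iff mult.commute)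
      with factor show ?thesis
        by (simp add: map_matrix_of_int_mult M conjugate_diag_mult[OF QP])
    qed
    then show ?case by blast
  qed
  define X where "X a = range l - {a}" for a
  have "\<forall>a. \<exists>M. cmat M = P ** diag_matrix (g (X a)) ** Q"
    using integer_polynomial by (simp add: X_def)
  then obtain M where M: "\<And>a. cmat (M a) = P ** diag_matrix (g (X a)) ** Q" by metis
  have row: "row i (M (l j)) v* B = l j *s row i (M (l j))" for i j
  proof -
    let ?a = "l j"
    have gl: "g (X ?a) i * of_int (l i) = of_int ?a * g (X ?a) i" for i
    proof (cases "l i = ?a")
      case False
      then have "g (X ?a) i = 0" by (auto simp: g_def X_def intro!: prod_zero)
      then show ?thesis by simp
    qed simp
    have "cmat (M ?a ** B) = P ** diag_matrix (\<lambda>i. of_int ?a * g (X ?a) i) ** Q"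
      by (subst map_matrix_of_int_mult, subst M, subst B, subst D_diag)
        (simp add: Q_def[symmetric] conjugate_diag_mult[OF QP] l gl)
    also have "\<dots> = mat (of_int ?a) ** cmat (M ?a)"
    proof -
      have "diag_matrix (\<lambda>i. of_int ?a * g (X ?a) i) = mat (of_int ?a) ** diag_matrix (g (X ?a))"
        by (simp add: diag_matrix_def vec_eq_iff mat_def matrix_matrix_mult_def sum_if_mult)
      then show ?thesis
        by (simp only: M matrix_mul_assoc matrix_mult_mat_commute[of P])
    qed
    also have "\<dots> = cmat (mat ?a ** M ?a)"
      by (simp add: vec_eq_iff mat_def matrix_matrix_mult_def sum_if_mult)
    finally have "M ?a ** B = mat ?a ** M ?a" by (simp only: cmat_eq_iff)
    then have "(M ?a ** B) $ i $ s = ?a * M ?a $ i $ s" for s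
      by (simp add: matrix_matrix_mult_def mat_def sum_if_mult)
    then show ?thesis
      by (simp add: vec_eq_iff row_def vector_matrix_mult_def matrix_matrix_mult_def mult.commute)
  qed
  show ?thesis
  proof (rule that[of "(\<lambda>(i, j). row i (M (l j))) ` UNIV"])
    show "\<exists>c. matrix_eigenvalue (cmat B) (of_int c) \<and> v v* B = c *s v"
      if v: "v \<in> (\<lambda>(i, j). row i (M (l j))) ` UNIV" for v
    proof -
      obtain i j where v: "v = row i (M (l j))" using v by auto
      show ?thesis unfolding v using row[of i j] eig[of j] l[of j] by auto
    qed
    fix x :: "complex^'n"
    assume "(\<Sum>i\<in>UNIV. of_int (v $ i) * x $ i) = 0" if "v \<in> (\<lambda>(i, j). row i (M (l j))) ` UNIV" for v
    then have "cmat (M (l j)) *v x = 0" for j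
      by (force simp: vec_eq_iff matrix_vector_mult_def row_def)
    then have "Q *v ((P ** diag_matrix (g (X (l j))) ** Q) *v x) = 0" for j
      by (simp add: M)
    then have "(Q ** P) *v (diag_matrix (g (X (l j))) *v (Q *v x)) = 0" for j
      by (simp only: matrix_vector_mul_assoc matrix_mul_assoc)
    then have "g (X (l j)) j * (Q *v x) $ j = 0" for j
      by (simp add: QP diag_matrix_vec vec_eq_iff)
    moreover have "g (X (l j)) j \<noteq> 0" for j by (auto simp: g_def X_def)
    ultimately have "Q *v x = 0" by (simp add: vec_eq_iff)
    then have "(P ** Q) *v x = 0" by (simp add: matrix_vector_mul_assoc[symmetric])
    then show "x = 0" by (simp add: PQ)
  qed simp
qed

lemma matrix_power_vec: "matrix_power A k *v x = (((*v) A) ^^ k) x"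
  for x :: "'a::comm_semiring_1^'n"
  by (induction k) (simp_all add: matrix_vector_mul_assoc[symmetric])

text \<open>If \<open>A\<^sup>k v = c v\<close> and \<open>z\<^sup>k = c\<close>, then \<open>u z = \<Sum>\<^bsub>i < k\<^esub> z\<^sup>i A\<^bsup>k - 1 - i\<^esup> v\<close> satisfies \<open>A (u z) = z (u z)\<close> by
  telescoping, so \<open>z\<close> is an eigenvalue of \<open>A\<close> unless \<open>u z = 0\<close>. Each coordinate of \<open>u z\<close> is a polynomial
  in \<open>z\<close> of degree less than \<open>k\<close>, and for a suitable coordinate it is not the zero polynomial; so
  \<open>u\<close> cannot vanish at all \<open>k\<close> distinct \<open>k\<close>-th roots of a nonzero \<open>c\<close>.\<close>

lemma eigenvalue_of_power:
  fixes A :: "complex^'n::finite^'n"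
  assumes k: "k > 0" and eig: "matrix_eigenvalue (matrix_power A k) c"
  obtains z where "matrix_eigenvalue A z" "z ^ k = c"
proof -
  let ?T = "\<lambda>j v. (((*v) A) ^^ j) v"
  obtain v where v: "v \<noteq> 0" "?T k v = c *s v"
    using eig unfolding matrix_eigenvalue_def matrix_power_vec by blast
  show ?thesis
  proof (cases "c = 0")
    case True
    \<comment> \<open>The last nonzero iterate of \<open>v\<close> lies in the kernel of \<open>A\<close>.\<close>
    define j where "j = (LEAST j. ?T j v = 0)"
    have "?T k v = 0" using v True by simp
    then have j: "?T j v = 0" unfolding j_def by (rule LeastI)
    then have "j \<noteq> 0" using v(1) by (intro notI) simp
    then obtain i where i: "j = Suc i" using not0_implies_Suc by blast
    then have "?T i v \<noteq> 0" using not_less_Least[of i "\<lambda>j. ?T j v = 0"] by (simp add: j_def)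
    moreover have "A *v ?T i v = 0 *s ?T i v" using j i by simp
    ultimately have "matrix_eigenvalue A 0" unfolding matrix_eigenvalue_def by blast
    then show ?thesis using that[of 0] k True by simp
  next
    case False
    define u where "u z = (\<Sum>i<k. z ^ i *s ?T (k - Suc i) v)" for z
    have T_u: "A *v u z = z *s u z" if "z ^ k = c" for z
    proof -
      let ?h = "\<lambda>i. z ^ i *s ?T (k - i) v"
      have "A *v u z = (\<Sum>i<k. z ^ i *s ?T (Suc (k - Suc i)) v)"
        unfolding u_def
        by (subst sum_comp_morphism[of "(*v) A", symmetric])
          (simp_all add: matrix_vector_right_distrib vector_scalar_commute)
      also have "\<dots> = (\<Sum>i<k. ?h i)"
        by (intro sum.cong refl) (simp add: Suc_diff_Suc)
      finally have 1: "A *v u z = (\<Sum>i<k. ?h i)" .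
      have 2: "z *s u z = (\<Sum>i<k. ?h (Suc i))"
        by (simp add: u_def vec_eq_iff sum_distrib_left mult_ac)
      have "(\<Sum>i<k. ?h (Suc i)) - (\<Sum>i<k. ?h i) = ?h k - ?h 0"
        by (subst sum_subtractf[symmetric]) (rule sum_lessThan_telescope)
      also have "\<dots> = 0" using that v(2) by simp
      finally show ?thesis using 1 2 by simp
    qed
    have "\<exists>z. z ^ k = c \<and> u z \<noteq> 0"
    proof (rule ccontr)
      assume "\<not> ?thesis"
      then have zero: "u z = 0" if "z ^ k = c" for z using that by blast
      obtain m where m: "v $ m \<noteq> 0" using v(1) by (auto simp: vec_eq_iff)
      define q where "q i = ?T (k - Suc i) v $ m" for i
      have Kk: "{..k - 1} = {..<k}" using k by auto
      \<comment> \<open>The leading coefficient is the coordinate \<open>v $ m\<close> itself.\<close>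
      have "q (k - 1) \<noteq> 0" using m k by (simp add: q_def)
      then have *: "\<exists>i\<le>k - 1. q i \<noteq> 0" by blast
      have sub: "{z. z ^ k = c} \<subseteq> {z. (\<Sum>i\<le>k - 1. q i * z ^ i) = 0}"
      proof clarify
        fix z assume "c = z ^ k"
        then have "u z $ m = 0" using zero by simp
        then show "(\<Sum>i\<le>k - 1. q i * z ^ i) = 0"
          unfolding Kk by (simp add: u_def q_def mult.commute)
      qed
      have "k \<le> k - 1"
        using card_mono[OF polyfun_rootbound_finite[OF *] sub] polyfun_rootbound_card[OF *]
          card_nth_roots[OF False k] by linarith
      then show False using k by simp
    qed
    then show ?thesis using T_u that unfolding matrix_eigenvalue_def by blast
  qed
qed

section \<open>Projecting polytopes to the torus\<close>

lemma int_lattice_small_eq_0: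
  assumes "z \<in> int_lattice" "norm z < 1"
  shows "z = 0"
proof -
  have "z $ i = 0" for i
  proof -
    have "\<bar>z $ i\<bar> < 1" using component_le_norm_cart[of z i] assms(2) by linarith
    moreover have "z $ i \<in> \<int>" using assms(1) by (simp add: int_lattice_def)
    ultimately show ?thesis by (metis Ints_nonzero_abs_less1)
  qed
  then show ?thesis by (simp add: vec_eq_iff)
qed

lemma no_int_between:
  assumes "real_of_int n < of_int m" "of_int m < real_of_int n + 1"
  shows False
proof -
  have "real_of_int m < of_int (n + 1)" using assms(2) by simp
  then have "m < n + 1" by (simp only: of_int_less_iff)
  then show False using assms(1) by simp
qed

lemma inner_int_lattice: "x \<in> int_lattice \<Longrightarrow> y \<in> int_lattice \<Longrightarrow> x \<bullet> y \<in> \<int>"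
  by (auto simp: int_lattice_def inner_vec_def intro!: Ints_sum Ints_mult)

lemma torus_proj_eqE:
  assumes "torus_proj x = torus_proj y"
  obtains z where "z \<in> int_lattice" "x = y + z"
  using assms that[of "x - y"] by (simp add: torus_proj_eq_iff)

lemma torus_proj_add_lattice: "z \<in> int_lattice \<Longrightarrow> torus_proj (x + z) = torus_proj x"
  by (simp add: torus_proj_eq_iff)

lemma open_torus_proj_image:
  assumes "open U"
  shows "open (torus_proj ` U)"
proof -
  have "torus_proj -` torus_proj ` U = (\<Union>z\<in>int_lattice. (+) z ` U)"
  proof (intro set_eqI iffI)
    fix x assume "x \<in> torus_proj -` torus_proj ` U"
    then obtain u where u: "u \<in> U" "torus_proj x = torus_proj u" by auto
    then obtain z where "z \<in> int_lattice" "x = z + u" by (metis torus_proj_eqE add.commute)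
    then show "x \<in> (\<Union>z\<in>int_lattice. (+) z ` U)" using u(1) by blast
  next
    fix x assume "x \<in> (\<Union>z\<in>int_lattice. (+) z ` U)"
    then obtain z u where "z \<in> int_lattice" "u \<in> U" "x = u + z" by (auto simp: add.commute)
    then show "x \<in> torus_proj -` torus_proj ` U" by (simp add: torus_proj_add_lattice)
  qed
  moreover have "open (\<Union>z\<in>int_lattice. (+) z ` U)"
    by (intro open_UN ballI open_translation assms)
  ultimately show ?thesis by (simp only: open_torus_iff)
qed

text \<open>A point of \<open>K\<close> whose image is interior has a neighbourhood that projects into the image. Points
  near it are congruent to points of \<open>K\<close>, and the congruence is an equality because the lattice
  vector involved is shorter than \<open>1\<close>; so the neighbourhood lies in \<open>K\<close> itself.\<close>

lemma interior_torus_proj: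
  assumes small: "\<And>x y. x \<in> K \<Longrightarrow> y \<in> K \<Longrightarrow> dist x y < 1/2"
  shows "interior (torus_proj ` K) = torus_proj ` interior K"
proof
  show "torus_proj ` interior K \<subseteq> interior (torus_proj ` K)"
    by (intro interior_maximal open_torus_proj_image image_mono interior_subset open_interior)
  show "interior (torus_proj ` K) \<subseteq> torus_proj ` interior K"
  proof
    fix p assume p: "p \<in> interior (torus_proj ` K)"
    then obtain y where y: "y \<in> K" "p = torus_proj y" using interior_subset by blast
    define U where "U = torus_proj -` interior (torus_proj ` K) \<inter> ball y (1/2)"
    have "open U" unfolding U_def
      by (intro open_Int open_vimage continuous_on_torus_proj open_interior open_ball)
    moreover have "U \<subseteq> K"
    proof
      fix u assume u: "u \<in> U"
      then obtain a where a: "a \<in> K" "torus_proj u = torus_proj a"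
        unfolding U_def using interior_subset by blast
      have "dist u a < 1"
        using u dist_triangle[of u a y] small[OF y(1) a(1)] by (auto simp: U_def dist_commute)
      then have "u - a = 0"
        using a(2) by (intro int_lattice_small_eq_0) (auto simp: torus_proj_eq_iff dist_norm)
      then show "u \<in> K" using a by simp
    qed
    moreover have "y \<in> U" using p y by (simp add: U_def)
    ultimately have "y \<in> interior K" by (meson interior_maximal subsetD)
    then show "p \<in> torus_proj ` interior K" using y by blast
  qed
qed

lemma frontier_torus_proj:
  assumes small: "\<And>x y. x \<in> K \<Longrightarrow> y \<in> K \<Longrightarrow> dist x y < 1/2" and K: "compact K"
  shows "frontier (torus_proj ` K) = torus_proj ` frontier K"
proof -
  have "closed (torus_proj ` K)"
    by (intro compact_imp_closed compact_continuous_image continuous_on_torus_proj K)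
  moreover have "inj_on torus_proj K"
  proof (rule inj_onI)
    fix x y assume "x \<in> K" "y \<in> K" "torus_proj x = torus_proj y"
    then have "x - y = 0"
      using small[of x y] by (intro int_lattice_small_eq_0) (auto simp: torus_proj_eq_iff dist_norm)
    then show "x = y" by simp
  qed
  ultimately show ?thesis
    using interior_subset[of K] compact_imp_closed[OF K]
    by (simp add: frontier_def interior_torus_proj[OF small] closure_closed inj_on_image_set_diff)
qed

lemma proper_torus_proj:
  assumes small: "\<And>x y. x \<in> K \<Longrightarrow> y \<in> K \<Longrightarrow> dist x y < 1/2"
    and K: "compact K" "convex K" "interior K \<noteq> {}"
  shows "proper_set (torus_proj ` K)"
proof -
  have "torus_proj ` closure (interior K) \<subseteq> closure (torus_proj ` interior K)"
    by (intro image_closure_subset closure_subset closed_closure continuous_on_torus_proj)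
  then have "torus_proj ` K \<subseteq> closure (interior (torus_proj ` K))"
    using K by (simp add: convex_closure_interior closure_closed compact_imp_closed
        interior_torus_proj[OF small])
  moreover have "closed (torus_proj ` K)"
    by (intro compact_imp_closed compact_continuous_image continuous_on_torus_proj K)
  then have "closure (interior (torus_proj ` K)) \<subseteq> torus_proj ` K"
    by (intro closure_minimal interior_subset)
  ultimately show ?thesis
    unfolding proper_set_def using K(3) interior_subset by fastforce
qed

lemma piecewise_linear_frontier_polytope:
  fixes K :: "(real^'n::finite) set"
  assumes small: "\<And>x y. x \<in> K \<Longrightarrow> y \<in> K \<Longrightarrow> dist x y < 1/2"
    and K: "polytope K" "interior K \<noteq> {}"
  shows "piecewise_linear_set (frontier (torus_proj ` K))"
  unfolding piecewise_linear_set_def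
proof (intro exI conjI ballI)
  show "finite {F. F facet_of K}" by (rule finite_polytope_facets[OF K(1)])
  show "polytope F" "aff_dim F \<le> int CARD('n) - 1" if "F \<in> {F. F facet_of K}" for F
    using that face_of_polytope_polytope[OF K(1)] aff_dim_le_DIM[of K] by (auto simp: facet_of_def)
  have "frontier K = \<Union>{F. F facet_of K}"
    using rel_frontier_of_polyhedron[OF polytope_imp_polyhedron[OF K(1)]]
      rel_frontier_nonempty_interior[OF K(2)] by simp
  then show "frontier (torus_proj ` K) = (\<Union>F\<in>{F. F facet_of K}. torus_proj ` F)"
    using frontier_torus_proj[OF small polytope_imp_compact[OF K(1)]] by auto
qed

lemma piecewise_linear_UN:
  fixes S :: "'i \<Rightarrow> 'n::finite torus set"
  assumes "finite I" "\<And>i. i \<in> I \<Longrightarrow> piecewise_linear_set (S i)"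
  shows "piecewise_linear_set (\<Union>i\<in>I. S i)"
proof -
  obtain F :: "'i \<Rightarrow> (real^'n) set set" where F: "\<And>i. i \<in> I \<Longrightarrow> finite (F i) \<and> (\<forall>P\<in>F i. polytope P \<and> aff_dim P \<le> int CARD('n) - 1) \<and>
      S i = (\<Union>P\<in>F i. torus_proj ` P)"
    using assms(2) unfolding piecewise_linear_set_def by metis
  show ?thesis unfolding piecewise_linear_set_def
  proof (intro exI conjI ballI)
    show "finite (\<Union>i\<in>I. F i)" using F assms(1) by blast
    show "(\<Union>i\<in>I. S i) = (\<Union>P\<in>(\<Union>i\<in>I. F i). torus_proj ` P)" using F by auto
    show "polytope P" "aff_dim P \<le> int CARD('n) - 1" if "P \<in> (\<Union>i\<in>I. F i)" for P
      using F that by blast+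
  qed
qed

definition torus_lift :: "int^'n::finite^'n \<Rightarrow> real^'n \<Rightarrow> real^'n" where
  "torus_lift A x = map_matrix real_of_int A *v x"

lemma funpow_torus_lift:
  "(torus_lift A ^^ k) x = map_matrix real_of_int (matrix_power A k) *v x"
proof -
  have "torus_lift A = (*v) (map_matrix real_of_int A)" by (simp add: fun_eq_iff torus_lift_def)
  then show ?thesis by (simp only: map_matrix_of_int_power matrix_power_vec)
qed

lemma linear_torus_lift: "linear (torus_lift A)"
  unfolding torus_lift_def by (rule matrix_vector_mul_linear)

section \<open>The partition cut out by an invariant grid\<close>

text \<open>
  Assumption \<open>W_pullback\<close> makes the grid forward invariant. Assumption \<open>W_small\<close> bounds the diameters
  of cells and of their images under \<open>A\<close> by \<open>1/2\<close>, so that a lattice vector which is a difference of two such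
  displacements has norm below \<open>1\<close> and vanishes.
\<close>

locale invariant_grid =
  fixes A :: "int^'n::finite^'n" and W :: "(real^'n) set"
  assumes finite_W: "finite W"
    and W_integral: "w \<in> W \<Longrightarrow> w \<in> int_lattice"
    and W_nonzero: "w \<in> W \<Longrightarrow> w \<noteq> 0"
    and W_pullback: "w \<in> W \<Longrightarrow> \<exists>w'\<in>W. \<exists>c::int. c \<noteq> 0 \<and> (\<forall>x. w' \<bullet> torus_lift A x = of_int c * (w \<bullet> x))"
    and W_small: "(\<And>w. w \<in> W \<Longrightarrow> \<bar>w \<bullet> x\<bar> \<le> 1) \<Longrightarrow> norm x < 1/2 \<and> norm (torus_lift A x) < 1/2"
    and T_expansive: "bounded (range (\<lambda>k. (torus_lift A ^^ k) e)) \<Longrightarrow> e = 0"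
begin

abbreviation "T \<equiv> torus_lift A"

text \<open>
  A closed cell is indexed by an integer for each covector. The address of a point records the
  floors of its coordinates \<open>w \<bullet> x\<close>; it is set to \<open>0\<close> outside \<open>W\<close>, so that two points have equal
  addresses as soon as these floors agree.
\<close>

definition grid :: "(real^'n) set" where
  "grid = {x. \<exists>w\<in>W. w \<bullet> x \<in> \<int>}"

definition cell :: "(real^'n \<Rightarrow> int) \<Rightarrow> (real^'n) set" where
  "cell m = (\<Inter>w\<in>W. {x. of_int (m w) \<le> w \<bullet> x} \<inter> {x. w \<bullet> x \<le> of_int (m w) + 1})"

definition address :: "real^'n \<Rightarrow> real^'n \<Rightarrow> int" where
  "address x w = (if w \<in> W then \<lfloor>w \<bullet> x\<rfloor> else 0)"

definition tiles :: "'n torus set set" where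
  "tiles = {torus_proj ` cell (address x) | x. x \<notin> grid}"

lemma T_diff: "T (x - y) = T x - T y"
  by (rule linear_diff[OF linear_torus_lift])

lemma T_0 [simp]: "T 0 = 0"
  by (rule linear_0[OF linear_torus_lift])

lemma toral_endo_T: "toral_endo A (torus_proj x) = torus_proj (T x)"
  by (simp add: torus_lift_def toral_endo_proj)

lemma toral_endo_funpow: "(toral_endo A ^^ k) (torus_proj x) = torus_proj ((T ^^ k) x)"
  by (induction k) (simp_all add: toral_endo_T)

text \<open>A kernel vector has a bounded orbit, so expansiveness forces it to vanish.\<close>

lemma bij_T: "bij T"
proof -
  have "x = 0" if "T x = 0" for x
  proof (rule T_expansive)
    have "(T ^^ k) x \<in> {x, 0}" for k
      by (induction k) (use that in auto)
    then show "bounded (range (\<lambda>k. (T ^^ k) x))"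
      by (meson bounded_subset finite_imp_bounded finite.intros image_subsetI)
  qed
  then show ?thesis using linear_torus_lift
    by (metis bijI linear_injective_0 linear_injective_imp_surjective)
qed

lemma cell_iff: "x \<in> cell m \<longleftrightarrow> (\<forall>w\<in>W. of_int (m w) \<le> w \<bullet> x \<and> w \<bullet> x \<le> of_int (m w) + 1)"
  by (auto simp: cell_def)

lemma mem_cell_address: "x \<in> cell (address x)"
  by (auto simp: cell_iff address_def)

lemma interior_cell: "interior (cell m) = {x. \<forall>w\<in>W. of_int (m w) < w \<bullet> x \<and> w \<bullet> x < of_int (m w) + 1}"
proof -
  have "interior (cell m) = (\<Inter>w\<in>W. interior ({x. of_int (m w) \<le> w \<bullet> x} \<inter> {x. w \<bullet> x \<le> of_int (m w) + 1}))"
    unfolding cell_def using finite_W by (induction W) (simp_all del: interior_Int add: interior_Int)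
  also have "\<dots> = (\<Inter>w\<in>W. {x. of_int (m w) < w \<bullet> x} \<inter> {x. w \<bullet> x < of_int (m w) + 1})"
    using W_nonzero by (simp add: interior_halfspace_le interior_halfspace_ge)
  finally show ?thesis by auto
qed

lemma mem_interior_cell_address:
  "x \<in> interior (cell (address y)) \<longleftrightarrow> x \<notin> grid \<and> address x = address y"
proof
  assume x: "x \<in> interior (cell (address y))"
  then have *: "of_int (address y w) < w \<bullet> x \<and> w \<bullet> x < of_int (address y w) + 1" if "w \<in> W" for w
    using that by (simp add: interior_cell)
  have "w \<bullet> x \<notin> \<int>" if "w \<in> W" for w
    using *[OF that] by (auto elim!: Ints_cases)
  moreover have "address x w = address y w" for w
    using *[of w] by (cases "w \<in> W") (simp add: address_def[of x] floor_unique, simp add: address_def)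
  ultimately show "x \<notin> grid \<and> address x = address y" by (auto simp: grid_def)
next
  assume x: "x \<notin> grid \<and> address x = address y"
  have "of_int (address x w) < w \<bullet> x \<and> w \<bullet> x < of_int (address x w) + 1" if "w \<in> W" for w
  proof -
    have "w \<bullet> x \<notin> \<int>" using x that by (auto simp: grid_def)
    then have "w \<bullet> x \<noteq> of_int \<lfloor>w \<bullet> x\<rfloor>" by (metis Ints_of_int)
    then show ?thesis using that by (simp add: address_def) linarith
  qed
  then show "x \<in> interior (cell (address y))" using x by (simp add: interior_cell)
qed

lemma cell_diff:
  assumes "x \<in> cell m" "y \<in> cell m" "w \<in> W"
  shows "\<bar>w \<bullet> (x - y)\<bar> \<le> 1"
  using assms by (fastforce simp: cell_iff inner_diff_right)

lemma cell_small: "x \<in> cell m \<Longrightarrow> y \<in> cell m \<Longrightarrow> dist x y < 1/2"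
  using W_small[of "x - y"] cell_diff by (simp add: dist_norm)

lemma polytope_cell: "polytope (cell m)"
proof -
  have "bounded (cell m)"
  proof (cases "cell m = {}")
    case False
    then obtain y where "y \<in> cell m" by blast
    then have "cell m \<subseteq> ball y 1" using cell_small by (fastforce simp: dist_commute)
    then show ?thesis using bounded_ball bounded_subset by blast
  qed simp
  moreover have "polyhedron (cell m)" unfolding cell_def
    by (intro polyhedron_Inter) (auto simp: finite_W intro!: polyhedron_Int polyhedron_halfspace_le polyhedron_halfspace_ge)
  ultimately show ?thesis by (simp add: polytope_eq_bounded_polyhedron)
qed

text \<open>The covectors take integer values on the lattice, so translating by a lattice vector shifts
  every floor by an integer.\<close>

lemma address_lattice:
  assumes "z \<in> int_lattice"
  shows "y \<in> cell (address x) \<longleftrightarrow> y + z \<in> cell (address (x + z))" and "x + z \<in> grid \<longleftrightarrow> x \<in> grid"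
proof -
  have "\<exists>n. w \<bullet> z = of_int n" if "w \<in> W" for w
    using inner_int_lattice[OF W_integral[OF that] assms] by (auto elim: Ints_cases)
  then obtain n where n: "\<And>w. w \<in> W \<Longrightarrow> w \<bullet> z = of_int (n w)" by metis
  show "y \<in> cell (address x) \<longleftrightarrow> y + z \<in> cell (address (x + z))"
    by (auto simp: cell_iff address_def inner_add_right n)
  have "w \<bullet> (x + z) \<in> \<int> \<longleftrightarrow> w \<bullet> x \<in> \<int>" if "w \<in> W" for w
    using that by (simp add: inner_add_right n)
  then show "x + z \<in> grid \<longleftrightarrow> x \<in> grid" by (auto simp: grid_def)
qed

lemma torus_proj_cell_translate:
  assumes z: "z \<in> int_lattice"
  shows "torus_proj ` cell (address (x + z)) = torus_proj ` cell (address x)"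
proof -
  have "cell (address (x + z)) = (\<lambda>y. y + z) ` cell (address x)"
  proof (intro set_eqI iffI)
    fix y assume "y \<in> cell (address (x + z))"
    then have "y - z \<in> cell (address x)" using address_lattice(1)[OF z, of "y - z" x] by simp
    then show "y \<in> (\<lambda>y. y + z) ` cell (address x)" by (rule rev_image_eqI) simp
  qed (use address_lattice(1)[OF z] in auto)
  then show ?thesis using z by (simp add: image_image torus_proj_add_lattice)
qed

lemma interior_tile:
  "interior (torus_proj ` cell (address x)) = torus_proj ` {y. y \<notin> grid \<and> address y = address x}"
  by (subst interior_torus_proj[OF cell_small])
    (auto simp: mem_interior_cell_address intro!: arg_cong[where f = "(`) torus_proj"])

lemma tile_at_interior_point:
  assumes "x \<notin> grid" "torus_proj x \<in> interior (torus_proj ` cell (address y))"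
  shows "torus_proj ` cell (address y) = torus_proj ` cell (address x)"
proof -
  obtain u where u: "u \<notin> grid" "address u = address y" "torus_proj x = torus_proj u"
    using assms(2) unfolding interior_tile by auto
  then obtain z where "z \<in> int_lattice" "x = u + z" by (elim torus_proj_eqE)
  then show ?thesis using torus_proj_cell_translate u(2) by metis
qed

lemma interior_tile_off_grid:
  assumes "torus_proj x \<in> interior (torus_proj ` cell (address y))"
  shows "x \<notin> grid"
  using assms address_lattice(2) unfolding interior_tile by (auto elim!: torus_proj_eqE)

text \<open>Up to a lattice translation the base point of a tile lies in the unit cube, where the
  coordinates \<open>w \<bullet> x\<close> are bounded, so only finitely many addresses occur.\<close>

lemma finite_tiles: "finite tiles"
proof -
  define b where "b w = (\<Sum>i\<in>UNIV. \<bar>w $ i\<bar>)" for w :: "real^'n"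
  define F where "F = PiE W (\<lambda>w. {\<lfloor>- b w\<rfloor>..\<lfloor>b w\<rfloor>})"
  have "finite F" unfolding F_def by (intro finite_PiE finite_W) simp
  moreover have "tiles \<subseteq> (\<lambda>m. torus_proj ` cell m) ` F"
  proof
    fix R assume "R \<in> tiles"
    then obtain x where R: "R = torus_proj ` cell (address x)" unfolding tiles_def by blast
    define z :: "real^'n" where "z = (\<chi> i. - of_int \<lfloor>x $ i\<rfloor>)"
    have z: "z \<in> int_lattice" by (simp add: z_def int_lattice_def)
    define y where "y = x + z"
    have y: "\<bar>y $ i\<bar> \<le> 1" for i by (simp add: y_def z_def) linarith
    have "\<bar>w \<bullet> y\<bar> \<le> b w" for w
    proof -
      have "\<bar>w \<bullet> y\<bar> \<le> (\<Sum>i\<in>UNIV. \<bar>w $ i * y $ i\<bar>)"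
        unfolding inner_vec_def by (simp add: sum_abs)
      also have "\<dots> \<le> b w" unfolding b_def
        by (intro sum_mono) (simp add: abs_mult mult_left_le y)
      finally show ?thesis .
    qed
    then have "- b w \<le> w \<bullet> y \<and> w \<bullet> y \<le> b w" for w by (meson abs_le_iff minus_le_iff)
    then have "restrict (address y) W \<in> F"
      by (auto simp: F_def address_def intro!: floor_mono)
    moreover have "cell (restrict (address y) W) = cell (address y)"
      by (auto simp: cell_iff)
    moreover have "R = torus_proj ` cell (address y)"
      unfolding R y_def by (rule torus_proj_cell_translate[OF z, symmetric])
    ultimately show "R \<in> (\<lambda>m. torus_proj ` cell m) ` F" by (metis image_eqI)
  qed
  ultimately show ?thesis using finite_subset finite_imageI by metis
qed

lemma negligible_grid: "negligible grid"
proof -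
  have "grid = (\<Union>(w, n)\<in>W \<times> (UNIV :: int set). {x. w \<bullet> x = of_int n})"
    by (auto simp: grid_def elim!: Ints_cases) (metis Ints_of_int)
  moreover have "countable ((\<lambda>(w, n). {x. w \<bullet> x = of_int n}) ` (W \<times> (UNIV :: int set)))"
    using finite_W by (intro countable_image countable_SIGMA) (simp_all add: countable_finite)
  then have "negligible (\<Union>(w, n)\<in>W \<times> (UNIV :: int set). {x. w \<bullet> x = of_int n})"
    by (rule negligible_countable_Union)
      (use W_nonzero[of 0] in \<open>auto intro!: negligible_hyperplane\<close>)
  ultimately show ?thesis by simp
qed

text \<open>The tiles cover everything off the grid. Their union is closed, and the grid is null, hence
  contains no nonempty open set.\<close>

lemma tiles_cover: "\<Union>tiles = UNIV"
proof (rule ccontr)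
  assume "\<Union>tiles \<noteq> UNIV"
  moreover have "closed (\<Union>tiles)"
    by (intro closed_Union finite_tiles) (auto simp: tiles_def intro!: compact_imp_closed
        compact_continuous_image continuous_on_torus_proj polytope_imp_compact polytope_cell)
  then have "open (torus_proj -` (- \<Union>tiles))"
    by (intro open_vimage continuous_on_torus_proj) (simp add: open_Compl)
  moreover obtain p where "p \<notin> \<Union>tiles" using \<open>\<Union>tiles \<noteq> UNIV\<close> by blast
  then have "torus_proj -` (- \<Union>tiles) \<noteq> {}" using surj_torus_proj[of p] by blast
  ultimately have "\<not> negligible (torus_proj -` (- \<Union>tiles))"
    by (intro open_not_negligible)
  moreover have "torus_proj -` (- \<Union>tiles) \<subseteq> grid"
  proof
    fix x assume "x \<in> torus_proj -` (- \<Union>tiles)"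
    then have "torus_proj ` cell (address x) \<notin> tiles" using mem_cell_address by blast
    then show "x \<in> grid" unfolding tiles_def by blast
  qed
  ultimately show False using negligible_grid negligible_subset by blast
qed

text \<open>The heart of the Markov property. An integer \<open>j\<close> strictly between \<open>w \<bullet> x\<close> and \<open>w \<bullet> y\<close> would yield
  the integer \<open>c * j\<close> strictly between \<open>w' \<bullet> T x\<close> and \<open>w' \<bullet> T y\<close>, which have the same floor. So \<open>x\<close>
  and \<open>y\<close> are not separated by the grid.\<close>

lemma pullback_interior_cell:
  assumes x: "x \<notin> grid" and y: "T y \<notin> grid" "address (T y) = address (T x)"
  shows "y \<in> cell (address x)"
proof -
  have "\<lfloor>w \<bullet> y\<rfloor> = \<lfloor>w \<bullet> x\<rfloor>" if w: "w \<in> W" for w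
  proof -
    obtain w' c where w': "w' \<in> W" "c \<noteq> 0" "\<And>x. w' \<bullet> T x = of_int c * (w \<bullet> x)"
      using W_pullback[OF w] by blast
    define n where "n = \<lfloor>w' \<bullet> T x\<rfloor>"
    have Ty: "T y \<in> interior (cell (address (T x)))" using y by (simp add: mem_interior_cell_address)
    have y': "of_int n < of_int c * (w \<bullet> y)" "of_int c * (w \<bullet> y) < of_int n + 1"
      using Ty w' by (auto simp: interior_cell address_def n_def)
    have x': "of_int n \<le> of_int c * (w \<bullet> x)" "of_int c * (w \<bullet> x) < of_int n + 1"
      using w'(3)[of x] by (auto simp: n_def)
    have no_integer_between: False
      if s: "of_int n \<le> of_int c * s" "of_int c * s < of_int n + (1::real)"
        and t: "of_int n \<le> of_int c * t" "of_int c * t < of_int n + (1::real)"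
        and j: "s < of_int j" "of_int j < t" for s t :: real and j :: int
    proof (cases "c > 0")
      case True
      then have "real_of_int c * s < of_int (c * j)" "of_int (c * j) < of_int c * t" using j by simp_all
      then have "real_of_int n < of_int (c * j)" "of_int (c * j) < real_of_int n + 1"
        using s t by linarith+
      then show False using no_int_between by blast
    next
      case False
      then have "real_of_int c * t < of_int (c * j)" "of_int (c * j) < of_int c * s"
        using j w'(2) by simp_all
      then have "real_of_int n < of_int (c * j)" "of_int (c * j) < real_of_int n + 1"
        using s t by linarith+
      then show False using no_int_between by blast
    qed
    have "w \<bullet> y \<noteq> of_int j" for j
    proof
      assume "w \<bullet> y = of_int j"
      then have "real_of_int n < of_int (c * j)" "of_int (c * j) < real_of_int n + 1" using y' by simp_all
      then show False using no_int_between by blast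
    qed
    moreover have "w \<bullet> x \<noteq> of_int j" for j using x w by (auto simp: grid_def)
    ultimately have not_int: "w \<bullet> y \<noteq> of_int j" "w \<bullet> x \<noteq> of_int j" for j by blast+
    show ?thesis
    proof (rule linorder_cases)
      assume *: "\<lfloor>w \<bullet> y\<rfloor> < \<lfloor>w \<bullet> x\<rfloor>"
      have "of_int \<lfloor>w \<bullet> x\<rfloor> < w \<bullet> x" using not_int(2) of_int_floor_le by (metis order_le_less)
      then show ?thesis
        using no_integer_between[OF less_imp_le[OF y'(1)] y'(2) x', of "\<lfloor>w \<bullet> x\<rfloor>"] *
        unfolding floor_less_iff by blast
    next
      assume *: "\<lfloor>w \<bullet> x\<rfloor> < \<lfloor>w \<bullet> y\<rfloor>"
      have "of_int \<lfloor>w \<bullet> y\<rfloor> < w \<bullet> y" using not_int(1) of_int_floor_le by (metis order_le_less)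
      then show ?thesis
        using no_integer_between[OF x' less_imp_le[OF y'(1)] y'(2), of "\<lfloor>w \<bullet> y\<rfloor>"] *
        unfolding floor_less_iff by blast
    qed
  qed
  then show ?thesis using mem_cell_address[of y] by (simp add: cell_iff address_def)
qed

text \<open>Let \<open>e\<close> be the difference of two lifts, in a common cell, of points with the same itinerary. At each
  time the difference of the iterated lifts is a displacement inside a cell up to a lattice vector,
  and by induction this lattice vector is too short to be nonzero. So the orbit of \<open>e\<close> is bounded
  and \<open>e = 0\<close>.\<close>

lemma tiles_metrically_generating: "metrically_generating (toral_endo A) tiles"
  unfolding metrically_generating_def
proof (intro allI impI)
  fix R :: "nat \<Rightarrow> 'n torus set" and p q
  assume R: "\<forall>k. R k \<in> tiles"
    and p: "p \<in> (\<Inter>k. (toral_endo A ^^ k) -` interior (R k))"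
    and q: "q \<in> (\<Inter>k. (toral_endo A ^^ k) -` interior (R k))"
  have tile: "\<exists>m. R k = torus_proj ` cell m" for k using R unfolding tiles_def by blast
  have orbit: "(toral_endo A ^^ k) p \<in> R k" "(toral_endo A ^^ k) q \<in> R k" for k
    using INT_D[OF p UNIV_I, of k] INT_D[OF q UNIV_I, of k] interior_subset by auto
  have "p \<in> R 0" "q \<in> R 0" using orbit[of 0] by simp_all
  then obtain u v m where uv: "p = torus_proj u" "q = torus_proj v" "u \<in> cell m" "v \<in> cell m"
    using tile[of 0] by auto
  define e where "e k = (T ^^ k) u - (T ^^ k) v" for k
  have e_Suc: "e (Suc k) = T (e k)" for k by (simp add: e_def T_diff)
  have e_small: "w \<in> W \<Longrightarrow> \<bar>w \<bullet> e k\<bar> \<le> 1" for k w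
  proof (induction k arbitrary: w)
    case 0
    then show ?case using cell_diff[OF uv(3,4)] by (simp add: e_def)
  next
    case (Suc k)
    obtain m where m: "R (Suc k) = torus_proj ` cell m" using tile by blast
    have "torus_proj ((T ^^ Suc k) u) \<in> R (Suc k)" "torus_proj ((T ^^ Suc k) v) \<in> R (Suc k)"
      using orbit[of "Suc k"] unfolding uv(1,2) toral_endo_funpow .
    then obtain a b where ab: "a \<in> cell m" "b \<in> cell m"
      and "torus_proj ((T ^^ Suc k) u) = torus_proj a" "torus_proj ((T ^^ Suc k) v) = torus_proj b"
      unfolding m by blast
    then obtain y z where yz: "y \<in> int_lattice" "z \<in> int_lattice"
      "(T ^^ Suc k) u = a + y" "(T ^^ Suc k) v = b + z"
      by (metis torus_proj_eqE)
    \<comment> \<open>Both terms on the left are shorter than \<open>1/2\<close>, so the lattice vector on the right is zero.\<close>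
    have e: "e (Suc k) - (a - b) = y - z" using yz(3,4) by (simp add: e_def)
    have "norm (e (Suc k)) < 1/2" unfolding e_Suc using W_small Suc.IH by blast
    moreover have "norm (a - b) < 1/2" using cell_small[OF ab] by (simp add: dist_norm)
    ultimately have "norm (y - z) < 1" unfolding e[symmetric]
      using norm_triangle_ineq4[of "e (Suc k)" "a - b"] by linarith
    moreover have "y - z \<in> int_lattice"
      using add_int_lattice[OF yz(1) minus_int_lattice[OF yz(2)]] by simp
    ultimately have "e (Suc k) = a - b" using e int_lattice_small_eq_0 by fastforce
    then show ?case using cell_diff[OF ab] Suc.prems by simp
  qed
  have "(T ^^ k) (u - v) = e k" for k
    by (induction k) (simp_all add: e_def T_diff)
  moreover have "norm (e k) < 1/2" for k using W_small e_small by blast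
  ultimately have "bounded (range (\<lambda>k. (T ^^ k) (u - v)))"
    by (auto simp: bounded_iff intro!: exI[of _ "1/2"] less_imp_le)
  then have "u - v = 0" by (rule T_expansive)
  then show "p = q" using uv by simp
qed

text \<open>The two tiles may be based at a point \<open>x\<close> and at its image \<open>T x\<close>. Existence of preimages is
  \<open>pullback_interior_cell\<close>; they are unique because \<open>T\<close> maps a difference of two points of a cell to a vector
  shorter than \<open>1\<close>, which vanishes if it is a lattice vector.\<close>

lemma tiles_markov: "markov_property (toral_endo A) tiles"
  unfolding markov_property_def
proof (intro ballI impI)
  fix R R' q
  assume R: "R \<in> tiles" "R' \<in> tiles" and meet: "toral_endo A ` interior R \<inter> interior R' \<noteq> {}"
    and q: "q \<in> interior R'"
  obtain p where p: "p \<in> interior R" "toral_endo A p \<in> interior R'" using meet by blast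
  obtain x where x: "p = torus_proj x" using surj_torus_proj by metis
  obtain a b where ab: "R = torus_proj ` cell (address a)" "R' = torus_proj ` cell (address b)"
    using R unfolding tiles_def by blast
  have off: "x \<notin> grid" "T x \<notin> grid"
    using interior_tile_off_grid p unfolding ab x toral_endo_T by blast+
  have R_x: "R = torus_proj ` cell (address x)" and R'_Tx: "R' = torus_proj ` cell (address (T x))"
    using tile_at_interior_point off p unfolding ab x toral_endo_T by blast+
  obtain v where v: "v \<notin> grid" "address v = address (T x)" "q = torus_proj v"
    using q unfolding R'_Tx interior_tile by blast
  obtain y where y: "T y = v" using bij_T by (metis bij_pointE)
  have y_cell: "y \<in> cell (address x)" using pullback_interior_cell off(1) v(1,2) y by simp
  show "\<exists>!p. p \<in> R \<and> toral_endo A p = q"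
  proof (rule ex1I[of _ "torus_proj y"])
    show "torus_proj y \<in> R \<and> toral_endo A (torus_proj y) = q"
      using y_cell y v(3) by (simp add: R_x toral_endo_T)
    fix p' assume p': "p' \<in> R \<and> toral_endo A p' = q"
    then obtain u where u: "u \<in> cell (address x)" "p' = torus_proj u" unfolding R_x by blast
    have "T (u - y) \<in> int_lattice"
      using p' u(2) v(3) y by (simp add: toral_endo_T torus_proj_eq_iff T_diff)
    moreover have "norm (T (u - y)) < 1"
      using W_small[of "u - y"] cell_diff[OF u(1) y_cell] by fastforce
    ultimately have "T (u - y) = T 0" by (simp add: int_lattice_small_eq_0)
    then have "u - y = 0" using bij_T by (metis bij_is_inj injD)
    then show "p' = torus_proj y" using u by simp
  qed
qed

lemma interior_cell_nonempty: "x \<notin> grid \<Longrightarrow> interior (cell (address x)) \<noteq> {}"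
  using mem_interior_cell_address by blast

lemma markov_partition_tiles: "markov_partition (toral_endo A) tiles"
  unfolding markov_partition_def
proof (intro conjI finite_tiles tiles_cover ballI tiles_metrically_generating tiles_markov)
  fix R assume "R \<in> tiles"
  then obtain x where R: "R = torus_proj ` cell (address x)" "x \<notin> grid" using tiles_def by blast
  show "proper_set R" unfolding R(1)
  proof (rule proper_torus_proj)
    show "dist u v < 1/2" if "u \<in> cell (address x)" "v \<in> cell (address x)" for u v
      using that by (rule cell_small)
    show "compact (cell (address x))" by (rule polytope_imp_compact[OF polytope_cell])
    show "convex (cell (address x))" by (rule polytope_imp_convex[OF polytope_cell])
    show "interior (cell (address x)) \<noteq> {}" by (rule interior_cell_nonempty[OF R(2)])
  qed
next
  show "pairwise (\<lambda>R R'. interior R \<inter> interior R' = {}) tiles"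
  proof (rule pairwiseI, rule ccontr)
    fix R R' assume R: "R \<in> tiles" "R' \<in> tiles" "R \<noteq> R'" "interior R \<inter> interior R' \<noteq> {}"
    then obtain x where x: "torus_proj x \<in> interior R" "torus_proj x \<in> interior R'"
      using surj_torus_proj by (metis disjoint_iff)
    obtain a b where ab: "R = torus_proj ` cell (address a)" "R' = torus_proj ` cell (address b)"
      using R unfolding tiles_def by blast
    have "x \<notin> grid" using interior_tile_off_grid x unfolding ab by blast
    then have "R = R'" using tile_at_interior_point x unfolding ab by blast
    then show False using R by blast
  qed
qed

lemma linear_partition_tiles: "linear_partition tiles"
  unfolding linear_partition_def partition_boundary_def
proof (rule piecewise_linear_UN[OF finite_tiles])
  fix R assume "R \<in> tiles"
  then obtain x where R: "R = torus_proj ` cell (address x)" "x \<notin> grid" using tiles_def by blast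
  show "piecewise_linear_set (frontier R)" unfolding R(1)
  proof (rule piecewise_linear_frontier_polytope)
    show "dist u v < 1/2" if "u \<in> cell (address x)" "v \<in> cell (address x)" for u v
      using that by (rule cell_small)
  qed (rule polytope_cell, rule interior_cell_nonempty[OF R(2)])
qed

end

section \<open>Constructing an invariant grid\<close>

text \<open>The seminorm \<open>\<Sum>v\<in>V. \<bar>v \<bullet> x\<bar>\<close> is a norm, so it is bounded below by its positive minimum on the unit
  sphere times the Euclidean norm.\<close>

lemma separating_functionals_bound:
  fixes V :: "('a::euclidean_space) set"
  assumes fin: "finite V" and sep: "\<And>x. (\<And>v. v \<in> V \<Longrightarrow> v \<bullet> x = 0) \<Longrightarrow> x = 0"
  obtains C where "C > 0" "\<And>x. (\<And>v. v \<in> V \<Longrightarrow> \<bar>v \<bullet> x\<bar> \<le> 1) \<Longrightarrow> norm x \<le> C"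
proof -
  define g where "g x = (\<Sum>v\<in>V. \<bar>v \<bullet> x\<bar>)" for x
  have "continuous_on (sphere 0 1) g" unfolding g_def by (intro continuous_intros)
  moreover have "sphere (0::'a) 1 \<noteq> {}" by simp
  ultimately obtain u where u: "u \<in> sphere 0 1" "\<And>y. y \<in> sphere 0 1 \<Longrightarrow> g u \<le> g y"
    using continuous_attains_inf[OF compact_sphere] by metis
  have "g u \<noteq> 0"
  proof
    assume "g u = 0"
    then have "v \<bullet> u = 0" if "v \<in> V" for v
      using that fin by (simp add: g_def sum_nonneg_eq_0_iff)
    then have "u = 0" by (rule sep)
    then show False using u(1) by simp
  qed
  moreover have "g u \<ge> 0" unfolding g_def by (rule sum_nonneg) simp
  ultimately have pos: "g u > 0" by linarith
  show ?thesis
  proof (rule that[of "card V / g u + 1"])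
    show "card V / g u + 1 > 0" using pos by (simp add: add_nonneg_pos)
    fix x assume x: "\<And>v. v \<in> V \<Longrightarrow> \<bar>v \<bullet> x\<bar> \<le> 1"
    have "norm x * g u \<le> g x"
    proof (cases "x = 0")
      case False
      have "g u \<le> g (x /\<^sub>R norm x)" using False by (intro u(2)) simp
      also have "\<dots> = g x / norm x"
        by (simp add: g_def abs_mult sum_distrib_left divide_inverse mult.commute)
      finally show ?thesis using False by (simp add: field_simps)
    qed (simp add: g_def)
    also have "g x \<le> card V" unfolding g_def using sum_bounded_above[of V "\<lambda>v. \<bar>v \<bullet> x\<bar>" 1] x by simp
    finally show "norm x \<le> card V / g u + 1" using pos by (simp add: field_simps)
  qed
qed

text \<open>Since \<open>v A\<^sup>k = l v\<close> with \<open>\<bar>l\<bar> > 1\<close>, the covectors \<open>v A\<^sup>j\<close> for \<open>j < k\<close> form a cycle up to the factor \<open>l\<close>.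
  The same factor makes a bounded orbit vanish: \<open>v \<bullet> e\<close> is multiplied by \<open>l\<close> every \<open>k\<close> steps.\<close>

lemma exists_invariant_grid:
  fixes A :: "int^'n::finite^'n" and V :: "(real^'n) set"
  assumes k: "k > 0" and fin: "finite V" and V: "V \<subseteq> int_lattice" "0 \<notin> V"
    and eig: "\<And>v. v \<in> V \<Longrightarrow>
      \<exists>l::int. \<bar>l\<bar> > 1 \<and> (\<forall>x. v \<bullet> (torus_lift A ^^ k) x = of_int l * (v \<bullet> x))"
    and sep: "\<And>x. (\<And>v. v \<in> V \<Longrightarrow> v \<bullet> x = 0) \<Longrightarrow> x = 0"
  shows "\<exists>W. invariant_grid A W"
proof -
  let ?R = "map_matrix real_of_int A"
  let ?T = "torus_lift A"
  define pull where "pull j v = ((\<lambda>u. u v* ?R) ^^ j) v" for j v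
  have inner_pull: "pull j v \<bullet> x = v \<bullet> (?T ^^ j) x" for j v x
  proof (induction j arbitrary: x)
    case (Suc j)
    have "pull (Suc j) v \<bullet> x = pull j v \<bullet> ?T x"
      by (simp add: pull_def dot_lmul_matrix torus_lift_def)
    also have "\<dots> = v \<bullet> (?T ^^ Suc j) x" by (simp only: Suc.IH funpow_Suc_right o_apply)
    finally show ?case .
  qed (simp add: pull_def)
  have pull_lattice: "pull j v \<in> int_lattice" if "v \<in> int_lattice" for j v
    using that unfolding pull_def
    by (induction j) (auto simp: int_lattice_def vector_matrix_mult_def intro!: Ints_sum Ints_mult)
  have pull_nonzero: "pull j v \<noteq> 0" if v: "v \<in> V" "j < k" for j v
  proof
    assume "pull j v = 0"
    obtain l where l: "\<bar>l\<bar> > 1" "\<And>x. v \<bullet> (?T ^^ k) x = of_int l * (v \<bullet> x)" using eig[OF v(1)] by blast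
    have "(?T ^^ j) ((?T ^^ (k - j)) v) = (?T ^^ k) v"
      using v(2) funpow_add[of j "k - j" ?T] by simp
    then have "of_int l * (v \<bullet> v) = 0"
      using inner_pull[of j v "(?T ^^ (k - j)) v"] \<open>pull j v = 0\<close> l(2)[of v] by simp
    then show False using l(1) v(1) V(2) by auto
  qed
  obtain C where C: "C > 0" "\<And>x. (\<And>v. v \<in> V \<Longrightarrow> \<bar>v \<bullet> x\<bar> \<le> 1) \<Longrightarrow> norm x \<le> C"
    using separating_functionals_bound[OF fin sep] by metis
  obtain K where K: "K > 0" "\<And>x. norm (?T x) \<le> K * norm x"
    using linear_bounded_pos[OF linear_torus_lift] by blast
  \<comment> \<open>A point with \<open>\<bar>N (v \<bullet> x)\<bar> \<le> 1\<close> for all \<open>v\<close> has norm at most \<open>C / N\<close>, and its image at most \<open>K C / N\<close>.\<close>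
  obtain N :: nat where N: "real N > 2 * C * (1 + K)" using reals_Archimedean2 by blast
  moreover have "2 * C * (1 + K) > 0" using C(1) K(1) by simp
  ultimately have N_pos: "real N > 0" by linarith
  define W where "W = (\<lambda>(v, j). real N *\<^sub>R pull j v) ` (V \<times> {..<k})"
  have "invariant_grid A W"
  proof
    show "finite W" using fin by (simp add: W_def)
  next
    fix w assume "w \<in> W"
    then obtain v j where w: "w = real N *\<^sub>R pull j v" "v \<in> V" "j < k" unfolding W_def by auto
    show "w \<noteq> 0" using w pull_nonzero N_pos by simp
    have "pull j v \<in> int_lattice" using pull_lattice w(2) V(1) by blast
    then show "w \<in> int_lattice" by (auto simp: w(1) int_lattice_def)
    show "\<exists>w'\<in>W. \<exists>c::int. c \<noteq> 0 \<and> (\<forall>x. w' \<bullet> ?T x = of_int c * (w \<bullet> x))"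
    proof (cases j)
      case 0
      obtain l where l: "\<bar>l\<bar> > 1" "\<And>x. v \<bullet> (?T ^^ k) x = of_int l * (v \<bullet> x)" using eig[OF w(2)] by blast
      have "(?T ^^ (k - 1)) (?T x) = (?T ^^ k) x" for x
        using k by (metis Suc_pred' funpow_Suc_right o_apply)
      then have "(real N *\<^sub>R pull (k - 1) v) \<bullet> ?T x = of_int l * (w \<bullet> x)" for x
        by (simp add: inner_pull w(1) 0 l(2))
      moreover have "real N *\<^sub>R pull (k - 1) v \<in> W" using w(2) k by (auto simp: W_def)
      moreover have "l \<noteq> 0" using l(1) by auto
      ultimately show ?thesis by blast
    next
      case (Suc i)
      have "(real N *\<^sub>R pull i v) \<bullet> ?T x = of_int 1 * (w \<bullet> x)" for x
        by (simp add: inner_pull w(1) Suc funpow_swap1)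
      moreover have "real N *\<^sub>R pull i v \<in> W" using w(2,3) Suc by (auto simp: W_def)
      ultimately show ?thesis by (metis one_neq_zero)
    qed
  next
    fix x assume x: "\<And>w. w \<in> W \<Longrightarrow> \<bar>w \<bullet> x\<bar> \<le> 1"
    have "norm (real N *\<^sub>R x) \<le> C"
    proof (rule C(2))
      fix v assume "v \<in> V"
      then have "real N *\<^sub>R pull 0 v \<in> W" using k by (auto simp: W_def)
      then show "\<bar>v \<bullet> (real N *\<^sub>R x)\<bar> \<le> 1" using x by (fastforce simp: pull_def)
    qed
    then have "real N * norm x \<le> C" by simp
    then have "real N * norm x * (1 + K) \<le> C * (1 + K)" using K(1) by (intro mult_right_mono) auto
    also have "\<dots> < real N * (1/2)" using N by simp
    finally have "real N * (norm x * (1 + K)) < real N * (1/2)" by (simp only: mult.assoc)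
    then have "norm x * (1 + K) < 1/2" using N_pos by (simp only: mult_less_cancel_left_pos)
    then have "norm x + K * norm x < 1/2" by (simp add: algebra_simps)
    moreover have "0 \<le> K * norm x" using K(1) by simp
    ultimately show "norm x < 1/2 \<and> norm (?T x) < 1/2"
      using K(2)[of x] norm_ge_zero[of x] by linarith
  next
    fix e assume "bounded (range (\<lambda>n. (?T ^^ n) e))"
    then obtain M where M: "\<And>n. norm ((?T ^^ n) e) \<le> M" by (auto simp: bounded_iff)
    show "e = 0"
    proof (rule sep, rule ccontr)
      fix v assume v: "v \<in> V" "v \<bullet> e \<noteq> 0"
      obtain l where l: "\<bar>l\<bar> > 1" "\<And>x. v \<bullet> (?T ^^ k) x = of_int l * (v \<bullet> x)" using eig[OF v(1)] by blast
      have iter: "v \<bullet> (?T ^^ (k * n)) e = of_int l ^ n * (v \<bullet> e)" for n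
        by (induction n) (simp_all add: funpow_add l(2))
      have "real_of_int \<bar>l\<bar> > 1" using l(1) by linarith
      then obtain n where n: "norm v * M / \<bar>v \<bullet> e\<bar> < real_of_int \<bar>l\<bar> ^ n"
        using real_arch_pow by blast
      have "\<bar>v \<bullet> e\<bar> * real_of_int \<bar>l\<bar> ^ n = \<bar>v \<bullet> (?T ^^ (k * n)) e\<bar>"
        by (simp add: iter abs_mult power_abs)
      also have "\<dots> \<le> norm v * norm ((?T ^^ (k * n)) e)" by (rule Cauchy_Schwarz_ineq2)
      also have "\<dots> \<le> norm v * M" by (intro mult_left_mono M) simp
      finally show False using n v(2) by (simp add: field_simps)
    qed
  qed
  then show ?thesis by blast
qed

theorem theorem1p2:
  fixes A :: "int^'n::finite^'n" and k :: nat
  assumes "expanding_matrix A"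
    and "k > 0"
    and "diagonalizable_matrix (cmat (matrix_power A k))"
    and "\<And>c. matrix_eigenvalue (cmat (matrix_power A k)) c \<Longrightarrow> c \<in> \<int>"
  shows "\<exists>M. markov_partition (toral_endo A) M \<and> linear_partition M"
proof -
  let ?B = "matrix_power A k"
  obtain V where V: "finite V"
    "\<And>v. v \<in> V \<Longrightarrow> \<exists>l. matrix_eigenvalue (cmat ?B) (of_int l) \<and> v v* ?B = l *s v"
    "\<And>x::complex^'n. (\<And>v. v \<in> V \<Longrightarrow> (\<Sum>i\<in>UNIV. of_int (v $ i) * x $ i) = 0) \<Longrightarrow> x = 0"
    using integral_left_eigenvectors[OF assms(3,4)] by blast
  define re where "re v = (\<chi> i. real_of_int (v $ i))" for v :: "int^'n"
  have "\<exists>W. invariant_grid A W"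
  proof (rule exists_invariant_grid[where V = "re ` V - {0}"])
    show "re ` V - {0} \<subseteq> int_lattice" by (auto simp: re_def int_lattice_def)
    show "\<exists>l::int. \<bar>l\<bar> > 1 \<and> (\<forall>x. v \<bullet> (torus_lift A ^^ k) x = of_int l * (v \<bullet> x))"
      if v: "v \<in> re ` V - {0}" for v
    proof -
      obtain u where u: "v = re u" "u \<in> V" using v by blast
      obtain l where l: "matrix_eigenvalue (cmat ?B) (of_int l)" "u v* ?B = l *s u"
        using V(2)[OF u(2)] by blast
      obtain z where z: "matrix_eigenvalue (cmat A) z" "z ^ k = of_int l"
        using eigenvalue_of_power[OF assms(2)] l(1) unfolding map_matrix_of_int_power by metis
      have "cmod z > 1" using z(1) assms(1) unfolding expanding_matrix_def by blast
      then have "cmod (z ^ k) > 1" using assms(2) by (simp add: norm_power one_less_power)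
      then have "\<bar>l\<bar> > 1" by (simp add: z(2))
      moreover have "v v* map_matrix real_of_int ?B = of_int l *\<^sub>R v"
      proof -
        have "(v v* map_matrix real_of_int ?B) $ j = of_int ((u v* ?B) $ j)" for j
          by (simp add: u(1) re_def vector_matrix_mult_def)
        then show ?thesis by (simp add: l(2) u(1) re_def vec_eq_iff)
      qed
      then have "v \<bullet> (torus_lift A ^^ k) x = of_int l * (v \<bullet> x)" for x
        by (simp add: funpow_torus_lift flip: dot_lmul_matrix)
      ultimately show ?thesis by blast
    qed
    show "x = 0" if x: "\<And>v. v \<in> re ` V - {0} \<Longrightarrow> v \<bullet> x = 0" for x
    proof -
      have "(\<Sum>i\<in>UNIV. of_int (u $ i) * (\<chi> i. complex_of_real (x $ i)) $ i) = 0" if "u \<in> V" for u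
      proof -
        have "re u \<bullet> x = 0" using x[of "re u"] that by (cases "re u = 0") auto
        then have "complex_of_real (\<Sum>i\<in>UNIV. of_int (u $ i) * x $ i) = 0"
          by (simp add: inner_vec_def re_def)
        then show ?thesis by simp
      qed
      then have "(\<chi> i. complex_of_real (x $ i)) = 0" by (rule V(3))
      then show "x = 0" by (simp add: vec_eq_iff)
    qed
  qed (use V(1) assms(2) in auto)
  then obtain W where "invariant_grid A W" by blast
  then interpret invariant_grid A W .
  show ?thesis using markov_partition_tiles linear_partition_tiles by blast
qed

end
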